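(* Let $\{X, X_n, n\ge 1\}$ be a sequence of independent and identically distributed real random variables, let $S_n = X_1+\cdots+X_n$ for $n\ge 1$, and write $\mu = E[X]$ (which is finite under either hypothesis below). (1) If $E[X^4]<\infty$ and it is not the case that $X=\mu$ almost surely, then for every $0<\alpha\le 2$, $$\sum_{n=1}^{\infty}\left|\frac{S_n}{n}-\mu\right|^{\alpha}=\infty \quad \text{almost surely}.$$ (2) If $E[|X|^2]<\infty$, then for every $\alpha>2$ the sequence $\frac{S_n}{n}$ strongly almost surely converges to $\mu$ with order $\alpha$.
   Context: For $\alpha>0$ and random variables $Y, Y_n$ ($n\ge1$) on a common probability space, $\{Y_n\}$ is said to strongly almost surely converge to $Y$ with order $\alpha$ if $\sum_{n=1}^{\infty}|Y_n-Y|^{\alpha}<\infty$ almost surely. *)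

theory Defs
  imports "HOL-Probability.Probability"
begin

(* Sequences are indexed by n >= 1; the value at index 0 is irrelevant. The series
   is formed in ennreal, where it always has a value, possibly infinite. *)
definition deviation_series ::
  "real \<Rightarrow> (nat \<Rightarrow> 'a \<Rightarrow> real) \<Rightarrow> ('a \<Rightarrow> real) \<Rightarrow> 'a \<Rightarrow> ennreal" where
  "deviation_series \<alpha> Y L \<omega> = (\<Sum>n. ennreal (\<bar>Y (Suc n) \<omega> - L \<omega>\<bar> powr \<alpha>))"

definition strongly_as_converges ::
  "'a measure \<Rightarrow> real \<Rightarrow> (nat \<Rightarrow> 'a \<Rightarrow> real) \<Rightarrow> ('a \<Rightarrow> real) \<Rightarrow> bool" where
  "strongly_as_converges M \<alpha> Y L \<longleftrightarrow>
     0 < \<alpha> \<and> L \<in> borel_measurable M \<and> (\<forall>n\<ge>1. Y n \<in> borel_measurable M) \<and>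
     (AE \<omega> in M. deviation_series \<alpha> Y L \<omega> < \<infinity>)"

(* X is a generic copy of the X n: it has their law, and its joint law with them
   is not constrained. *)
definition iid_copies ::
  "'a measure \<Rightarrow> ('a \<Rightarrow> real) \<Rightarrow> (nat \<Rightarrow> 'a \<Rightarrow> real) \<Rightarrow> bool" where
  "iid_copies M X Xs \<longleftrightarrow>
     X \<in> borel_measurable M \<and>
     prob_space.indep_vars M (\<lambda>_. borel) Xs {1..} \<and>
     (\<forall>n\<ge>1. distr M borel (Xs n) = distr M borel X)"

definition sample_mean :: "(nat \<Rightarrow> 'a \<Rightarrow> real) \<Rightarrow> nat \<Rightarrow> 'a \<Rightarrow> real" where
  "sample_mean Xs n \<omega> = (\<Sum>i=1..n. Xs i \<omega>) / real n"

end

theory Submission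
  imports Defs
begin

text \<open>
  Write \<open>S\<^sub>n\<close> for the sum of the first \<open>n\<close> centred variables \<open>Xs i - \<mu>\<close> and \<open>v\<close> for their common
  variance. The order 2 is critical because \<open>S\<^sub>n\<^sup>2\<close> has size about \<open>v * n\<close>, so that
  \<open>(S\<^sub>n / n)\<^sup>2\<close> behaves like the harmonic series. Both halves rest on one fact,
  \<open>expectation_past_mult_S_square\<close>: the process \<open>S\<^sub>n\<^sup>2 - v * n\<close> is a martingale. It is stated with
  test functions measurable in the past, so conditional expectations do not occur.

  Divergence for \<open>\<alpha> \<le> 2\<close>. A sequence whose powers of order \<open>\<alpha>\<close> are summable tends to 0, hence its
  squares are summable as well, and it is enough to treat the order 2. The partial sums
  \<open>T\<^sub>n = (\<Sum>k=1..n. (S\<^sub>k / k)\<^sup>2)\<close> have mean \<open>v * harm n\<close>. The martingale property makes the covariance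
  of \<open>S\<^sub>k\<^sup>2\<close> and \<open>S\<^sub>n\<^sup>2\<close> for \<open>k \<le> n\<close> equal to the variance of \<open>S\<^sub>k\<^sup>2\<close>, and the fourth moment bounds
  this variance by a multiple of \<open>k\<^sup>2\<close>. After division by \<open>k\<^sup>2 * n\<^sup>2\<close> the covariances sum to a
  variance of \<open>T\<^sub>n\<close> of order \<open>harm n\<close> only, which is the order of the mean. As the mean tends to
  infinity, the standard deviation is negligible against it, and Chebyshev's inequality shows that
  \<open>T\<^sub>n\<close> is almost surely unbounded (\<open>AE_sum_squares_exceeds\<close>).

  Convergence for \<open>\<alpha> > 2\<close>. With second moments alone, \<open>\<bar>S\<^sub>n\<bar> powr \<alpha>\<close> may have infinite
  expectation, so the sum cannot be bounded in mean. Instead the Hajek--Renyi maximal inequality,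
  applied to the summable weights \<open>k powr - \<beta>\<close> with \<open>\<beta> > 1\<close>, shows that \<open>S\<^sub>k\<^sup>2 / k powr \<beta>\<close> is
  almost surely bounded. For \<open>\<beta>\<close> close enough to 1 this growth rate makes
  \<open>\<bar>S\<^sub>k / k\<bar> powr \<alpha>\<close> summable path by path (\<open>AE_summable_powr\<close>).
\<close>

section \<open>Integrability of powers and products\<close>

lemma integrable_mult_of_squares:
  fixes f g :: "'a \<Rightarrow> real"
  assumes [measurable]: "f \<in> borel_measurable M" "g \<in> borel_measurable M"
    and "integrable M (\<lambda>x. (f x)\<^sup>2)" "integrable M (\<lambda>x. (g x)\<^sup>2)"
  shows "integrable M (\<lambda>x. f x * g x)"
proof (rule Bochner_Integration.integrable_bound)
  show "integrable M (\<lambda>x. (f x)\<^sup>2 + (g x)\<^sup>2)"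
    using assms by simp
  have "\<bar>a * b\<bar> \<le> a\<^sup>2 + b\<^sup>2" for a b :: real
  proof -
    have "2 * \<bar>a * b\<bar> \<le> a\<^sup>2 + b\<^sup>2"
      using sum_squares_bound[of "\<bar>a\<bar>" "\<bar>b\<bar>"] by (simp add: abs_mult mult.assoc)
    then show ?thesis
      using abs_ge_zero[of "a * b"] by linarith
  qed
  then show "AE x in M. norm (f x * g x) \<le> norm ((f x)\<^sup>2 + (g x)\<^sup>2)"
    by simp
qed simp

lemma (in prob_space) integrable_power_le:
  fixes f :: "'a \<Rightarrow> real"
  assumes [measurable]: "f \<in> borel_measurable M"
    and "integrable M (\<lambda>x. f x ^ n)" "even n" "m \<le> n"
  shows "integrable M (\<lambda>x. f x ^ m)"
proof (rule Bochner_Integration.integrable_bound)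
  show "integrable M (\<lambda>x. 1 + f x ^ n)"
    using assms by simp
  have "\<bar>a ^ m\<bar> \<le> 1 + a ^ n" for a :: real
  proof (cases "\<bar>a\<bar> \<le> 1")
    case True
    then have "\<bar>a\<bar> ^ m \<le> 1" "0 \<le> a ^ n"
      using \<open>even n\<close> by (auto intro: power_le_one)
    then show ?thesis
      by (simp add: power_abs)
  next
    case False
    then have "\<bar>a\<bar> ^ m \<le> \<bar>a\<bar> ^ n"
      using \<open>m \<le> n\<close> by (intro power_increasing) auto
    also have "\<dots> = a ^ n"
      using \<open>even n\<close> by (rule power_even_abs)
    also have "\<dots> \<le> 1 + a ^ n"
      by simp
    finally show ?thesis
      by (simp add: power_abs)
  qed
  then have "norm (f x ^ m) \<le> norm (1 + f x ^ n)" for x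
    by (metis abs_ge_self order_trans real_norm_def)
  then show "AE x in M. norm (f x ^ m) \<le> norm (1 + f x ^ n)"
    by simp
qed simp

section \<open>Partial sums of independent centred variables\<close>

locale centred_sums = prob_space M for M :: "'a measure" +
  fixes Y :: "nat \<Rightarrow> 'a \<Rightarrow> real" and v :: real
  assumes indep: "indep_vars (\<lambda>_. borel) Y {1..}"
    and integrable_square: "1 \<le> i \<Longrightarrow> integrable M (\<lambda>\<omega>. (Y i \<omega>)\<^sup>2)"
    and expectation_summand: "1 \<le> i \<Longrightarrow> expectation (Y i) = 0"
    and expectation_square: "1 \<le> i \<Longrightarrow> expectation (\<lambda>\<omega>. (Y i \<omega>)\<^sup>2) = v"
begin

definition S :: "nat \<Rightarrow> 'a \<Rightarrow> real" where
  "S n \<omega> = (\<Sum>i=1..n. Y i \<omega>)"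

text \<open>The natural filtration of the summands.\<close>

definition past :: "nat \<Rightarrow> 'a measure" where
  "past n = vimage_algebra (space M) (\<lambda>\<omega>. \<lambda>i\<in>{1..n}. Y i \<omega>) (PiM {1..n} (\<lambda>_. borel))"

lemma S_0 [simp]: "S 0 \<omega> = 0"
  by (simp add: S_def)

lemma S_Suc: "S (Suc n) \<omega> = S n \<omega> + Y (Suc n) \<omega>"
  by (simp add: S_def)

lemma measurable_summand [measurable]: "1 \<le> i \<Longrightarrow> Y i \<in> borel_measurable M"
  using indep by (auto simp: indep_vars_def)

lemma measurable_S [measurable]: "S n \<in> borel_measurable M"
  unfolding S_def by measurable

lemma integrable_summand: "1 \<le> i \<Longrightarrow> integrable M (Y i)"
  by (rule square_integrable_imp_integrable) (auto intro: integrable_square)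

lemma v_nonneg: "0 \<le> v"
  using Bochner_Integration.integral_nonneg[of M "\<lambda>\<omega>. (Y 1 \<omega>)\<^sup>2"] expectation_square[of 1] by (simp del: One_nat_def)

lemma space_past [simp]: "space (past n) = space M"
  by (simp add: past_def)

lemma summand_measurable_past:
  assumes "i \<in> {1..n}"
  shows "Y i \<in> borel_measurable (past n)"
proof -
  have "(\<lambda>\<omega>. \<lambda>i\<in>{1..n}. Y i \<omega>) \<in> past n \<rightarrow>\<^sub>M PiM {1..n} (\<lambda>_. borel)"
    unfolding past_def by (rule measurable_vimage_algebra1) (auto simp: space_PiM)
  then have "(\<lambda>\<omega>. (\<lambda>i\<in>{1..n}. Y i \<omega>) i) \<in> borel_measurable (past n)"
    using assms by measurable
  then show ?thesis
    using assms by simp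
qed

lemma S_measurable_past: "k \<le> n \<Longrightarrow> S k \<in> borel_measurable (past n)"
  unfolding S_def using summand_measurable_past by (intro borel_measurable_sum) auto

text \<open>
  A past-measurable \<open>Z\<close> need not be exhibited as a function of the first \<open>n\<close> summands: independence
  concerns only the generated sigma-algebras, and both of those at hand are contained in the ones of
  two disjoint blocks of summands.
\<close>

lemma indep_past:
  assumes Z: "Z \<in> borel_measurable (past n)" and h [measurable]: "h \<in> borel_measurable borel"
  shows "indep_var borel (Z :: 'a \<Rightarrow> real) borel (\<lambda>\<omega>. h (Y (Suc n) \<omega>) :: real)"
proof -
  let ?P = "\<lambda>\<omega>. \<lambda>i\<in>{1..n}. Y i \<omega>"
  let ?N = "PiM {1..n} (\<lambda>_. borel) :: (nat \<Rightarrow> real) measure"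
  have rvP: "?P \<in> M \<rightarrow>\<^sub>M ?N"
    by (intro measurable_restrict) auto
  have sets_past: "sets (past n) = {?P -` A \<inter> space M |A. A \<in> sets ?N}"
    unfolding past_def by (rule sets_vimage_algebra2) (auto simp: space_PiM)
  have "sets (past n) \<subseteq> events"
    unfolding sets_past using measurable_sets[OF rvP] by blast
  then have Zm: "Z \<in> borel_measurable M"
    using Z by (simp add: in_borel_measurable_borel subset_iff)
  let ?R = "\<lambda>\<omega>. \<lambda>i\<in>{Suc n}. Y i \<omega>"
  let ?N' = "PiM {Suc n} (\<lambda>_. borel) :: (nat \<Rightarrow> real) measure"
  have iv: "indep_var ?N ?P ?N' ?R"
    by (rule indep_var_restrict[OF indep]) auto
  have Z_sub: "sigma_sets (space M) {Z -` A \<inter> space M |A. A \<in> sets borel}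
      \<subseteq> sigma_sets (space M) {?P -` A \<inter> space M |A. A \<in> sets ?N}"
    unfolding sets_past[symmetric]
    using measurable_sets[OF Z] by (intro sigma_sets_mono') (simp add: subset_iff, blast)
  have h_proj: "(\<lambda>f. h (f (Suc n))) \<in> borel_measurable ?N'"
    by measurable
  have "{(\<lambda>\<omega>. h (Y (Suc n) \<omega>)) -` A \<inter> space M |A. A \<in> sets borel}
      \<subseteq> {?R -` A \<inter> space M |A. A \<in> sets ?N'}"
  proof safe
    fix A :: "real set" assume "A \<in> sets borel"
    then have "(\<lambda>f. h (f (Suc n))) -` A \<inter> space ?N' \<in> sets ?N'"
      using h_proj by (rule measurable_sets[rotated])
    moreover have "(\<lambda>\<omega>. h (Y (Suc n) \<omega>)) -` A \<inter> space M =
        ?R -` ((\<lambda>f. h (f (Suc n))) -` A \<inter> space ?N') \<inter> space M"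
      by (auto simp: space_PiM)
    ultimately show "\<exists>B. (\<lambda>\<omega>. h (Y (Suc n) \<omega>)) -` A \<inter> space M = ?R -` B \<inter> space M \<and> B \<in> sets ?N'"
      by blast
  qed
  then have h_sub: "sigma_sets (space M) {(\<lambda>\<omega>. h (Y (Suc n) \<omega>)) -` A \<inter> space M |A. A \<in> sets borel}
      \<subseteq> sigma_sets (space M) {?R -` A \<inter> space M |A. A \<in> sets ?N'}"
    by (rule sigma_sets_mono')
  have rvh: "(\<lambda>\<omega>. h (Y (Suc n) \<omega>)) \<in> borel_measurable M"
    by measurable
  have "indep_set (sigma_sets (space M) {Z -` A \<inter> space M |A. A \<in> sets borel})
     (sigma_sets (space M) {(\<lambda>\<omega>. h (Y (Suc n) \<omega>)) -` A \<inter> space M |A. A \<in> sets borel})"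
  proof -
    have "indep_set (sigma_sets (space M) {?P -` A \<inter> space M |A. A \<in> sets ?N})
        (sigma_sets (space M) {?R -` A \<inter> space M |A. A \<in> sets ?N'})"
      using iv unfolding indep_var_eq by blast
    then show ?thesis
      unfolding indep_set_def using Z_sub h_sub
      by (elim indep_sets_mono_sets) (simp split: bool.split)
  qed
  with Zm show ?thesis
    using rvh unfolding indep_var_eq by blast
qed

lemma
  fixes Z :: "'a \<Rightarrow> real"
  assumes "Z \<in> borel_measurable (past n)" "h \<in> borel_measurable borel"
    and "integrable M Z" "integrable M (\<lambda>\<omega>. h (Y (Suc n) \<omega>))"
  shows integrable_past_mult: "integrable M (\<lambda>\<omega>. Z \<omega> * h (Y (Suc n) \<omega>))"
    and expectation_past_mult: "expectation (\<lambda>\<omega>. Z \<omega> * h (Y (Suc n) \<omega>)) =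
      expectation Z * expectation (\<lambda>\<omega>. h (Y (Suc n) \<omega>))"
  using indep_var_integrable[OF indep_past[OF assms(1,2)] assms(3,4)]
    indep_var_lebesgue_integral[OF indep_past[OF assms(1,2)] assms(3,4)] .

text \<open>
  The martingale property of \<open>S\<^sub>n\<^sup>2 - v * n\<close>, tested against a past-measurable \<open>Z\<close>. In the expansion
  of \<open>(S\<^sub>n + Y\<^sub>n\<^sub>+\<^sub>1)\<^sup>2\<close> the mixed term vanishes because \<open>Z * S\<^sub>n\<close> belongs to the past and the new
  summand is centred. The instance \<open>Z = 1\<close> gives the second moments of the sums, an indicator gives
  the maximal inequality, and an earlier value of the martingale gives the covariances.
\<close>

lemma
  fixes Z :: "'a \<Rightarrow> real"
  assumes Z [measurable]: "Z \<in> borel_measurable (past n)" and int: "integrable M Z"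
    "integrable M (\<lambda>\<omega>. Z \<omega> * S n \<omega>)" "integrable M (\<lambda>\<omega>. Z \<omega> * (S n \<omega>)\<^sup>2)"
  shows integrable_past_mult_S_square: "integrable M (\<lambda>\<omega>. Z \<omega> * (S (Suc n) \<omega>)\<^sup>2)"
    and expectation_past_mult_S_square: "expectation (\<lambda>\<omega>. Z \<omega> * (S (Suc n) \<omega>)\<^sup>2) =
      expectation (\<lambda>\<omega>. Z \<omega> * (S n \<omega>)\<^sup>2) + v * expectation Z"
proof -
  have ZS: "(\<lambda>\<omega>. Z \<omega> * S n \<omega>) \<in> borel_measurable (past n)"
    using S_measurable_past[of n n] by simp
  have 1: "integrable M (\<lambda>\<omega>. (Z \<omega> * S n \<omega>) * Y (Suc n) \<omega>)"
    "expectation (\<lambda>\<omega>. (Z \<omega> * S n \<omega>) * Y (Suc n) \<omega>) = 0"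
    using integrable_past_mult[OF ZS, of "\<lambda>x. x"] expectation_past_mult[OF ZS, of "\<lambda>x. x"]
    by (simp_all add: int integrable_summand expectation_summand)
  have 2: "integrable M (\<lambda>\<omega>. Z \<omega> * (Y (Suc n) \<omega>)\<^sup>2)"
    "expectation (\<lambda>\<omega>. Z \<omega> * (Y (Suc n) \<omega>)\<^sup>2) = v * expectation Z"
    using integrable_past_mult[OF Z, of "\<lambda>x. x\<^sup>2"] expectation_past_mult[OF Z, of "\<lambda>x. x\<^sup>2"]
    by (simp_all add: int integrable_square expectation_square mult.commute)
  have eq: "(\<lambda>\<omega>. Z \<omega> * (S (Suc n) \<omega>)\<^sup>2) = (\<lambda>\<omega>. Z \<omega> * (S n \<omega>)\<^sup>2 +
      2 * ((Z \<omega> * S n \<omega>) * Y (Suc n) \<omega>) + Z \<omega> * (Y (Suc n) \<omega>)\<^sup>2)"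
    by (simp add: S_Suc power2_sum algebra_simps)
  show "integrable M (\<lambda>\<omega>. Z \<omega> * (S (Suc n) \<omega>)\<^sup>2)"
    unfolding eq using 1 2 int by auto
  show "expectation (\<lambda>\<omega>. Z \<omega> * (S (Suc n) \<omega>)\<^sup>2) =
      expectation (\<lambda>\<omega>. Z \<omega> * (S n \<omega>)\<^sup>2) + v * expectation Z"
    unfolding eq using 1 2 int by auto
qed

lemma integrable_S: "integrable M (S n)"
  unfolding S_def by (auto intro!: integrable_summand)

lemma expectation_S: "expectation (S n) = 0"
proof -
  have "expectation (\<lambda>\<omega>. \<Sum>i=1..n. Y i \<omega>) = (\<Sum>i=1..n. expectation (Y i))"
    by (rule Bochner_Integration.integral_sum) (auto intro: integrable_summand)
  then show ?thesis
    by (simp add: S_def[abs_def] expectation_summand)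
qed

lemma
  shows integrable_S_square: "integrable M (\<lambda>\<omega>. (S n \<omega>)\<^sup>2)"
    and expectation_S_square: "expectation (\<lambda>\<omega>. (S n \<omega>)\<^sup>2) = v * real n"
proof (induction n)
  case 0
  show "integrable M (\<lambda>\<omega>. (S 0 \<omega>)\<^sup>2)" "expectation (\<lambda>\<omega>. (S 0 \<omega>)\<^sup>2) = v * real 0"
    by simp_all
next
  case (Suc n)
  have one: "(\<lambda>_. 1 :: real) \<in> borel_measurable (past n)" "integrable M (\<lambda>_. 1 :: real)"
      "integrable M (\<lambda>\<omega>. 1 * S n \<omega>)" "integrable M (\<lambda>\<omega>. 1 * (S n \<omega>)\<^sup>2)"
    using integrable_S[of n] Suc.IH(1) by simp_all
  show "integrable M (\<lambda>\<omega>. (S (Suc n) \<omega>)\<^sup>2)"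
    using integrable_past_mult_S_square[OF one] by simp
  have "expectation (\<lambda>\<omega>. (S (Suc n) \<omega>)\<^sup>2) = expectation (\<lambda>\<omega>. (S n \<omega>)\<^sup>2) + v"
    using expectation_past_mult_S_square[OF one] by (simp add: prob_space)
  then show "expectation (\<lambda>\<omega>. (S (Suc n) \<omega>)\<^sup>2) = v * real (Suc n)"
    using Suc.IH(2) by (simp add: distrib_left)
qed

section \<open>A maximal inequality and almost sure growth\<close>

text \<open>
  Let \<open>g n\<close> be the indicator of the event that the level \<open>l\<close> has not been reached up to time \<open>n\<close>. On
  this event the weighted square gains at most \<open>v * c (Suc n)\<close> in mean at the next step, since
  the weights decrease; when the level is reached, the weighted square is at least \<open>l\<close> and can be
  exchanged for \<open>l\<close> times the indicator lost. So the mean of the weighted square on the surviving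
  event plus \<open>l\<close> times the probability of having reached the level grows by at most
  \<open>v * c (Suc n)\<close> per step.
\<close>

lemma Hajek_Renyi:
  fixes c :: "nat \<Rightarrow> real"
  assumes c: "\<And>k. 0 \<le> c k" "\<And>k. c (Suc k) \<le> c k" and "0 < l"
  shows "l * prob {\<omega> \<in> space M. \<exists>k\<le>n. l \<le> c k * (S k \<omega>)\<^sup>2} \<le> v * (\<Sum>k=1..n. c k)"
proof -
  define g :: "nat \<Rightarrow> 'a \<Rightarrow> real" where
    "g n = indicator {\<omega> \<in> space M. \<forall>k\<le>n. c k * (S k \<omega>)\<^sup>2 < l}" for n
  have g_Suc: "g (Suc n) \<omega> = (if c (Suc n) * (S (Suc n) \<omega>)\<^sup>2 < l then g n \<omega> else 0)" for n \<omega>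
    by (auto simp: g_def le_Suc_eq split: split_indicator)
  have g_past: "g n \<in> borel_measurable (past n)" for n
  proof -
    have "{\<omega> \<in> space (past n). \<forall>k\<in>{..n}. c k * (S k \<omega>)\<^sup>2 < l} \<in> sets (past n)"
    proof (rule sets.sets_Collect_finite_All)
      fix k assume "k \<in> {..n}"
      then have [measurable]: "S k \<in> borel_measurable (past n)"
        by (intro S_measurable_past) simp
      show "{\<omega> \<in> space (past n). c k * (S k \<omega>)\<^sup>2 < l} \<in> sets (past n)"
        by measurable
    qed simp
    then have "{\<omega> \<in> space M. \<forall>k\<le>n. c k * (S k \<omega>)\<^sup>2 < l} \<in> sets (past n)"
      by (simp only: space_past Ball_def atMost_iff)
    then show ?thesis
      unfolding g_def by (rule borel_measurable_indicator)
  qed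
  have [measurable]: "g n \<in> borel_measurable M" for n
    unfolding g_def by measurable
  have g_bounds: "0 \<le> g n \<omega>" "g n \<omega> \<le> 1" for n \<omega>
    by (auto simp: g_def indicator_def)
  have int_mult: "integrable M (\<lambda>\<omega>. g n \<omega> * f \<omega>)" if "integrable M f" for n f
    by (rule Bochner_Integration.integrable_bound[OF that])
      (use that g_bounds in \<open>auto simp: abs_mult intro!: mult_left_le_one_le\<close>)
  have int_g: "integrable M (g n)" for n
    using int_mult[of "\<lambda>_. 1" n] by simp
  have int_gS: "integrable M (\<lambda>\<omega>. g n \<omega> * (S m \<omega>)\<^sup>2)" for m n
    by (rule int_mult[OF integrable_S_square])
  have main: "c n * expectation (\<lambda>\<omega>. g n \<omega> * (S n \<omega>)\<^sup>2) + l * (1 - expectation (g n))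
      \<le> v * (\<Sum>k=1..n. c k)" for n
  proof (induction n)
    case 0
    have "g 0 = indicator (space M)"
      using \<open>0 < l\<close> by (auto simp: g_def)
    then show ?case
      by (simp add: prob_space)
  next
    case (Suc n)
    have "c (Suc n) * expectation (\<lambda>\<omega>. g (Suc n) \<omega> * (S (Suc n) \<omega>)\<^sup>2) 
          + l * (expectation (g n) - expectation (g (Suc n)))
       = expectation (\<lambda>\<omega>. c (Suc n) * (g (Suc n) \<omega> * (S (Suc n) \<omega>)\<^sup>2) + l * (g n \<omega> - g (Suc n) \<omega>))"
      by (simp add: int_g int_gS)
    also have "\<dots> \<le> expectation (\<lambda>\<omega>. c (Suc n) * (g n \<omega> * (S (Suc n) \<omega>)\<^sup>2))"
    proof (rule integral_mono)
      show "c (Suc n) * (g (Suc n) \<omega> * (S (Suc n) \<omega>)\<^sup>2) + l * (g n \<omega> - g (Suc n) \<omega>)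
          \<le> c (Suc n) * (g n \<omega> * (S (Suc n) \<omega>)\<^sup>2)" for \<omega>
      proof (cases "c (Suc n) * (S (Suc n) \<omega>)\<^sup>2 < l")
        case False
        then have "l * g n \<omega> \<le> (c (Suc n) * (S (Suc n) \<omega>)\<^sup>2) * g n \<omega>"
          using g_bounds by (intro mult_right_mono) auto
        then show ?thesis
          using False by (simp add: g_Suc mult.commute mult.left_commute)
      qed (simp add: g_Suc)
    qed (simp_all add: int_g int_gS)
    also have "\<dots> = c (Suc n) * expectation (\<lambda>\<omega>. g n \<omega> * (S n \<omega>)\<^sup>2) + c (Suc n) * (v * expectation (g n))"
      using expectation_past_mult_S_square[OF g_past int_g int_mult[OF integrable_S] int_gS]
      by (simp add: algebra_simps)
    also have "\<dots> \<le> c n * expectation (\<lambda>\<omega>. g n \<omega> * (S n \<omega>)\<^sup>2) + c (Suc n) * (v * 1)"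
    proof (intro add_mono mult_left_mono mult_right_mono c v_nonneg)
      show "0 \<le> expectation (\<lambda>\<omega>. g n \<omega> * (S n \<omega>)\<^sup>2)"
        by (simp add: g_bounds)
      show "expectation (g n) \<le> 1"
        by (rule integral_le_const[OF int_g]) (simp add: g_bounds)
    qed
    finally show ?case
      using Suc.IH by (simp add: algebra_simps)
  qed
  let ?G = "{\<omega> \<in> space M. \<forall>k\<le>n. c k * (S k \<omega>)\<^sup>2 < l}"
  have G: "?G \<in> events"
    by measurable
  have "expectation (g n) = prob ?G"
    unfolding g_def using G by (simp add: Int_absorb2 sets.sets_into_space)
  also have "\<dots> = 1 - prob (space M - ?G)"
    using prob_compl[OF G] by simp
  also have "space M - ?G = {\<omega> \<in> space M. \<exists>k\<le>n. l \<le> c k * (S k \<omega>)\<^sup>2}"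
    by (auto simp: not_less)
  finally have "l * prob {\<omega> \<in> space M. \<exists>k\<le>n. l \<le> c k * (S k \<omega>)\<^sup>2} = l * (1 - expectation (g n))"
    by simp
  moreover have "0 \<le> c n * expectation (\<lambda>\<omega>. g n \<omega> * (S n \<omega>)\<^sup>2)"
    by (simp add: c g_bounds)
  ultimately show ?thesis
    using main[of n] by linarith
qed

text \<open>
  The bound of the maximal inequality is uniform in the time horizon when the weights are summable,
  so the probability of ever reaching the level \<open>Suc l\<close> is of order \<open>1 / Suc l\<close>.
\<close>

lemma AE_bounded_weighted_squares:
  fixes c :: "nat \<Rightarrow> real"
  assumes c: "\<And>k. 0 \<le> c k" "\<And>k. c (Suc k) \<le> c k" "summable c"
  shows "AE \<omega> in M. \<exists>K. \<forall>k. c k * (S k \<omega>)\<^sup>2 \<le> K"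
proof -
  define B where "B l n = {\<omega> \<in> space M. \<exists>k\<le>n. real (Suc l) \<le> c k * (S k \<omega>)\<^sup>2}" for l n
  define U where "U = {\<omega> \<in> space M. \<forall>l. \<exists>k. real (Suc l) \<le> c k * (S k \<omega>)\<^sup>2}"
  have [measurable]: "B l n \<in> events" "U \<in> events" for l n
    unfolding B_def U_def by measurable
  have B_le: "prob (B l n) \<le> v * (\<Sum>k. c k) / Suc l" for l n
  proof -
    have "real (Suc l) * prob (B l n) \<le> v * (\<Sum>k=1..n. c k)"
      unfolding B_def using c by (intro Hajek_Renyi) auto
    also have "\<dots> \<le> v * (\<Sum>k. c k)"
      using c v_nonneg by (intro mult_left_mono sum_le_suminf) auto
    finally show ?thesis
      by (simp add: field_simps)
  qed
  have U_le: "prob U \<le> v * (\<Sum>k. c k) / Suc l" for l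
  proof -
    have "(\<lambda>n. prob (B l n)) \<longlonglongrightarrow> prob (\<Union>n. B l n)"
      by (rule finite_Lim_measure_incseq) (auto simp: incseq_def B_def intro: order_trans)
    then have "prob (\<Union>n. B l n) \<le> v * (\<Sum>k. c k) / Suc l"
      using B_le by (intro LIMSEQ_le_const2) auto
    moreover have "U \<subseteq> (\<Union>n. B l n)"
      unfolding U_def B_def by blast
    then have "prob U \<le> prob (\<Union>n. B l n)"
      by (intro finite_measure_mono) auto
    ultimately show ?thesis by simp
  qed
  have "(\<lambda>l. v * (\<Sum>k. c k) / Suc l) \<longlonglongrightarrow> 0"
    using LIMSEQ_Suc[OF lim_const_over_n] .
  then have "prob U \<le> 0"
    by (rule LIMSEQ_le_const) (use U_le in blast)
  then have "prob U = 0"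
    using measure_nonneg[of M U] by linarith
  then have "AE \<omega> in M. \<omega> \<notin> U"
    by (simp add: prob_eq_0)
  then show ?thesis
  proof (rule AE_mp, intro AE_I2 impI)
    fix \<omega> assume "\<omega> \<in> space M" "\<omega> \<notin> U"
    then obtain l where "\<not> (\<exists>k. real (Suc l) \<le> c k * (S k \<omega>)\<^sup>2)"
      unfolding U_def by blast
    then have "\<forall>k. c k * (S k \<omega>)\<^sup>2 \<le> real (Suc l)"
      by (meson linear)
    then show "\<exists>K. \<forall>k. c k * (S k \<omega>)\<^sup>2 \<le> K" ..
  qed
qed

end

section \<open>Fourth moments and covariances of the squared sums\<close>

locale centred_sums_fourth = centred_sums +
  fixes \<kappa> :: real
  assumes integrable_fourth: "1 \<le> i \<Longrightarrow> integrable M (\<lambda>\<omega>. Y i \<omega> ^ 4)"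
    and expectation_fourth: "1 \<le> i \<Longrightarrow> expectation (\<lambda>\<omega>. Y i \<omega> ^ 4) \<le> \<kappa>"
begin

lemma \<kappa>_nonneg: "0 \<le> \<kappa>"
proof -
  have "0 \<le> expectation (\<lambda>\<omega>. Y 1 \<omega> ^ 4)"
    by (rule Bochner_Integration.integral_nonneg) simp
  then show ?thesis
    using expectation_fourth[of 1] by linarith
qed

text \<open>
  Of the mixed terms in the expansion of \<open>(S\<^sub>n + Y\<^sub>n\<^sub>+\<^sub>1)\<^sup>4\<close> only \<open>6 * S\<^sub>n\<^sup>2 * Y\<^sub>n\<^sub>+\<^sub>1\<^sup>2\<close> contributes, the
  other two having a centred factor. It adds \<open>6 * v\<^sup>2 * n\<close> at each step, which sums to about
  \<open>3 * v\<^sup>2 * n\<^sup>2\<close>.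
\<close>

lemma
  shows integrable_S_fourth: "integrable M (\<lambda>\<omega>. S n \<omega> ^ 4)"
    and expectation_S_fourth: "expectation (\<lambda>\<omega>. S n \<omega> ^ 4) \<le> (\<kappa> + 3 * v\<^sup>2) * (real n)\<^sup>2"
proof (induction n)
  case 0
  show "integrable M (\<lambda>\<omega>. S 0 \<omega> ^ 4)" "expectation (\<lambda>\<omega>. S 0 \<omega> ^ 4) \<le> (\<kappa> + 3 * v\<^sup>2) * (real 0)\<^sup>2"
    by simp_all
next
  case (Suc n)
  have past_pow: "(\<lambda>\<omega>. S n \<omega> ^ j) \<in> borel_measurable (past n)" for j
    using S_measurable_past[of n n] by simp
  have int_S: "integrable M (\<lambda>\<omega>. S n \<omega> ^ j)" if "j \<le> 4" for j
    by (rule integrable_power_le[OF _ Suc.IH(1)]) (use that in auto)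
  have int_Y: "integrable M (\<lambda>\<omega>. Y (Suc n) \<omega> ^ j)" if "j \<le> 4" for j
    by (rule integrable_power_le[OF _ integrable_fourth]) (use that in auto)
  have int: "integrable M (\<lambda>\<omega>. S n \<omega> ^ i * Y (Suc n) \<omega> ^ j)"
    and mult: "expectation (\<lambda>\<omega>. S n \<omega> ^ i * Y (Suc n) \<omega> ^ j) =
      expectation (\<lambda>\<omega>. S n \<omega> ^ i) * expectation (\<lambda>\<omega>. Y (Suc n) \<omega> ^ j)" if "i \<le> 4" "j \<le> 4" for i j
    using integrable_past_mult[OF past_pow, of "\<lambda>x. x ^ j"] expectation_past_mult[OF past_pow, of "\<lambda>x. x ^ j"]
      int_S[OF that(1)] int_Y[OF that(2)] by simp_all
  have eq: "(\<lambda>\<omega>. S (Suc n) \<omega> ^ 4) = (\<lambda>\<omega>. S n \<omega> ^ 4 + 4 * (S n \<omega> ^ 3 * Y (Suc n) \<omega> ^ 1)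
      + 6 * (S n \<omega> ^ 2 * Y (Suc n) \<omega> ^ 2) + 4 * (S n \<omega> ^ 1 * Y (Suc n) \<omega> ^ 3) + Y (Suc n) \<omega> ^ 4)"
    by (simp add: S_Suc fun_eq_iff power2_eq_square power3_eq_cube power4_eq_xxxx algebra_simps)
  show "integrable M (\<lambda>\<omega>. S (Suc n) \<omega> ^ 4)"
    unfolding eq by (intro Bochner_Integration.integrable_add integrable_mult_right int_Y int Suc.IH(1)) auto
  have "expectation (\<lambda>\<omega>. S (Suc n) \<omega> ^ 4) = expectation (\<lambda>\<omega>. S n \<omega> ^ 4)
      + 4 * expectation (\<lambda>\<omega>. S n \<omega> ^ 3 * Y (Suc n) \<omega> ^ 1)
      + 6 * expectation (\<lambda>\<omega>. S n \<omega> ^ 2 * Y (Suc n) \<omega> ^ 2)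
      + 4 * expectation (\<lambda>\<omega>. S n \<omega> ^ 1 * Y (Suc n) \<omega> ^ 3) + expectation (\<lambda>\<omega>. Y (Suc n) \<omega> ^ 4)"
    unfolding eq by (simp add: int int[of 3 1, simplified] int[of 1 3, simplified] int_Y Suc.IH(1))
  also have "expectation (\<lambda>\<omega>. S n \<omega> ^ 3 * Y (Suc n) \<omega> ^ 1) = 0"
    by (subst mult) (simp_all add: expectation_summand)
  also have "expectation (\<lambda>\<omega>. S n \<omega> ^ 2 * Y (Suc n) \<omega> ^ 2) = v * real n * v"
    by (subst mult) (simp_all add: expectation_square expectation_S_square)
  also have "expectation (\<lambda>\<omega>. S n \<omega> ^ 1 * Y (Suc n) \<omega> ^ 3) = 0"
    by (subst mult) (simp_all add: expectation_S)
  finally have "expectation (\<lambda>\<omega>. S (Suc n) \<omega> ^ 4)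
      \<le> (\<kappa> + 3 * v\<^sup>2) * (real n)\<^sup>2 + 6 * v\<^sup>2 * real n + \<kappa>"
    using Suc.IH(2) expectation_fourth[of "Suc n"] by (simp add: power2_eq_square algebra_simps)
  also have "\<dots> \<le> (\<kappa> + 3 * v\<^sup>2) * (real (Suc n))\<^sup>2"
    using \<kappa>_nonneg by (simp add: power2_eq_square algebra_simps)
  finally show "expectation (\<lambda>\<omega>. S (Suc n) \<omega> ^ 4) \<le> (\<kappa> + 3 * v\<^sup>2) * (real (Suc n))\<^sup>2" .
qed

text \<open>The martingale behind \<open>expectation_past_mult_S_square\<close>: the squared sum minus its mean.\<close>

definition Q :: "nat \<Rightarrow> 'a \<Rightarrow> real" where
  "Q n \<omega> = (S n \<omega>)\<^sup>2 - v * real n"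

lemma measurable_Q [measurable]: "Q n \<in> borel_measurable M"
  unfolding Q_def by measurable

lemma integrable_Q: "integrable M (Q n)"
  unfolding Q_def by (simp add: integrable_S_square)

lemma expectation_Q: "expectation (Q n) = 0"
  unfolding Q_def by (simp add: integrable_S_square expectation_S_square prob_space)

lemma Q_square: "(Q n \<omega>)\<^sup>2 = S n \<omega> ^ 4 - 2 * v * real n * (S n \<omega>)\<^sup>2 + (v * real n)\<^sup>2"
  by (simp add: Q_def power2_eq_square power4_eq_xxxx algebra_simps)

lemma integrable_Q_square: "integrable M (\<lambda>\<omega>. (Q n \<omega>)\<^sup>2)"
  unfolding Q_square by (simp add: integrable_S_fourth integrable_S_square)

lemma expectation_Q_square: "expectation (\<lambda>\<omega>. (Q n \<omega>)\<^sup>2) \<le> (\<kappa> + 3 * v\<^sup>2) * (real n)\<^sup>2"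
proof -
  have "expectation (\<lambda>\<omega>. (Q n \<omega>)\<^sup>2)
      = expectation (\<lambda>\<omega>. S n \<omega> ^ 4) - 2 * v * real n * (v * real n) + (v * real n)\<^sup>2"
    unfolding Q_square
    by (simp add: integrable_S_fourth integrable_S_square expectation_S_square prob_space)
  also have "\<dots> = expectation (\<lambda>\<omega>. S n \<omega> ^ 4) - (v * real n)\<^sup>2"
    by (simp add: power2_eq_square)
  also have "\<dots> \<le> expectation (\<lambda>\<omega>. S n \<omega> ^ 4)"
    by simp
  finally show ?thesis
    using expectation_S_fourth[of n] by linarith
qed

lemma integrable_Q_mult: "integrable M (\<lambda>\<omega>. Q m \<omega> * Q n \<omega>)"
  by (intro integrable_mult_of_squares integrable_Q_square) auto

text \<open>The increments of the martingale after time \<open>m\<close> are orthogonal to its value at time \<open>m\<close>.\<close>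

lemma expectation_Q_mult:
  assumes "m \<le> n"
  shows "expectation (\<lambda>\<omega>. Q m \<omega> * Q n \<omega>) = expectation (\<lambda>\<omega>. (Q m \<omega>)\<^sup>2)"
  using assms
proof (induction n rule: dec_induct)
  case base
  show ?case
    by (simp add: power2_eq_square)
next
  case (step n)
  have "S m \<in> borel_measurable (past n)"
    using step.hyps by (intro S_measurable_past) simp
  then have past: "Q m \<in> borel_measurable (past n)"
    unfolding Q_def by simp
  have QS: "integrable M (\<lambda>\<omega>. Q m \<omega> * S n \<omega>)" 
    by (intro integrable_mult_of_squares integrable_Q_square integrable_S_square) auto
  have "integrable M (\<lambda>\<omega>. ((S n \<omega>)\<^sup>2)\<^sup>2)"
    using integrable_S_fourth[of n] by simp
  then have QSS: "integrable M (\<lambda>\<omega>. Q m \<omega> * (S n \<omega>)\<^sup>2)"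
    by (intro integrable_mult_of_squares integrable_Q_square) auto
  have *: "expectation (\<lambda>\<omega>. Q m \<omega> * Q k \<omega>) = expectation (\<lambda>\<omega>. Q m \<omega> * (S k \<omega>)\<^sup>2)"
    if "integrable M (\<lambda>\<omega>. Q m \<omega> * (S k \<omega>)\<^sup>2)" for k
  proof -
    have "(\<lambda>\<omega>. Q m \<omega> * Q k \<omega>) = (\<lambda>\<omega>. Q m \<omega> * (S k \<omega>)\<^sup>2 - v * real k * Q m \<omega>)"
      by (simp add: Q_def[of k] algebra_simps)
    then show ?thesis
      using that by (simp add: integrable_Q expectation_Q)
  qed
  have "expectation (\<lambda>\<omega>. Q m \<omega> * Q (Suc n) \<omega>) = expectation (\<lambda>\<omega>. Q m \<omega> * (S (Suc n) \<omega>)\<^sup>2)"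
    by (rule *[OF integrable_past_mult_S_square[OF past integrable_Q QS QSS]])
  also have "\<dots> = expectation (\<lambda>\<omega>. Q m \<omega> * (S n \<omega>)\<^sup>2)"
    by (subst expectation_past_mult_S_square[OF past integrable_Q QS QSS]) (simp add: expectation_Q)
  also have "\<dots> = expectation (\<lambda>\<omega>. (Q m \<omega>)\<^sup>2)"
    using *[OF QSS] step.IH by simp
  finally show ?case .
qed

text \<open>
  The expectation bounded here is the variance of the sum of the \<open>(S\<^sub>k / k)\<^sup>2\<close>. At step \<open>N = Suc n\<close> each of the \<open>n\<close> new
  covariances is at most \<open>C * k\<^sup>2 / (k\<^sup>2 * N\<^sup>2) = C / N\<^sup>2\<close> and is counted twice, and the new variance
  is at most \<open>C / N\<^sup>2\<close> as well. Altogether the step adds no more than \<open>(2 * n + 1) * C / N\<^sup>2\<close>,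
  hence at most \<open>2 * C / N\<close>, the increment of \<open>2 * C * harm\<close> at that step.
\<close>

lemma
  shows integrable_weighted_sum_square: "integrable M (\<lambda>\<omega>. (\<Sum>k=1..n. Q k \<omega> / (real k)\<^sup>2)\<^sup>2)"
    and expectation_weighted_sum_square:
      "expectation (\<lambda>\<omega>. (\<Sum>k=1..n. Q k \<omega> / (real k)\<^sup>2)\<^sup>2) \<le> 2 * (\<kappa> + 3 * v\<^sup>2) * harm n"
proof (induction n)
  case 0
  show "integrable M (\<lambda>\<omega>. (\<Sum>k=1..0. Q k \<omega> / (real k)\<^sup>2)\<^sup>2)"
    "expectation (\<lambda>\<omega>. (\<Sum>k=1..0. Q k \<omega> / (real k)\<^sup>2)\<^sup>2) \<le> 2 * (\<kappa> + 3 * v\<^sup>2) * harm 0"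
    by (simp_all add: harm_def)
next
  case (Suc n)
  let ?C = "\<kappa> + 3 * v\<^sup>2" and ?N = "real (Suc n)"
  define W where "W \<omega> = (\<Sum>k=1..n. Q k \<omega> / (real k)\<^sup>2)" for \<omega>
  have eq: "(\<Sum>k=1..Suc n. Q k \<omega> / (real k)\<^sup>2)\<^sup>2 = (W \<omega>)\<^sup>2
      + (\<Sum>k=1..n. 2 / ((real k)\<^sup>2 * ?N\<^sup>2) * (Q k \<omega> * Q (Suc n) \<omega>)) + (Q (Suc n) \<omega>)\<^sup>2 / ?N ^ 4" for \<omega>
  proof -
    have "(\<Sum>k=1..n. 2 / ((real k)\<^sup>2 * ?N\<^sup>2) * (Q k \<omega> * Q (Suc n) \<omega>)) = 2 * W \<omega> * (Q (Suc n) \<omega> / ?N\<^sup>2)"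
      unfolding W_def sum_distrib_left sum_distrib_right by (intro sum.cong) simp_all
    moreover have "(Q (Suc n) \<omega> / ?N\<^sup>2)\<^sup>2 = (Q (Suc n) \<omega>)\<^sup>2 / ?N ^ 4"
      by (simp add: power_divide del: of_nat_Suc)
    moreover have "(\<Sum>k=1..Suc n. Q k \<omega> / (real k)\<^sup>2) = W \<omega> + Q (Suc n) \<omega> / ?N\<^sup>2"
      by (simp add: W_def)
    ultimately show ?thesis
      by (simp add: power2_sum)
  qed
  have int_W: "integrable M (\<lambda>\<omega>. (W \<omega>)\<^sup>2)" and exp_W: "expectation (\<lambda>\<omega>. (W \<omega>)\<^sup>2) \<le> 2 * ?C * harm n"
    using Suc.IH by (simp_all add: W_def)
  show "integrable M (\<lambda>\<omega>. (\<Sum>k=1..Suc n. Q k \<omega> / (real k)\<^sup>2)\<^sup>2)"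
    unfolding eq by (intro Bochner_Integration.integrable_add Bochner_Integration.integrable_sum
        integrable_mult_right integrable_divide integrable_Q_mult integrable_Q_square int_W)
  have cov: "2 / ((real k)\<^sup>2 * ?N\<^sup>2) * expectation (\<lambda>\<omega>. Q k \<omega> * Q (Suc n) \<omega>) \<le> 2 * ?C / ?N\<^sup>2"
    if "k \<in> {1..n}" for k
  proof -
    have "expectation (\<lambda>\<omega>. Q k \<omega> * Q (Suc n) \<omega>) \<le> ?C * (real k)\<^sup>2"
      using that expectation_Q_mult[of k "Suc n"] expectation_Q_square[of k] by simp
    then have "2 / ((real k)\<^sup>2 * ?N\<^sup>2) * expectation (\<lambda>\<omega>. Q k \<omega> * Q (Suc n) \<omega>)
        \<le> 2 / ((real k)\<^sup>2 * ?N\<^sup>2) * (?C * (real k)\<^sup>2)"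
      by (intro mult_left_mono) auto
    also have "\<dots> = 2 * ?C / ?N\<^sup>2"
      using that by (simp del: of_nat_Suc)
    finally show ?thesis .
  qed
  have "expectation (\<lambda>\<omega>. (\<Sum>k=1..Suc n. Q k \<omega> / (real k)\<^sup>2)\<^sup>2) = expectation (\<lambda>\<omega>. (W \<omega>)\<^sup>2)
      + (\<Sum>k=1..n. 2 / ((real k)\<^sup>2 * ?N\<^sup>2) * expectation (\<lambda>\<omega>. Q k \<omega> * Q (Suc n) \<omega>))
      + expectation (\<lambda>\<omega>. (Q (Suc n) \<omega>)\<^sup>2) / ?N ^ 4"
    unfolding eq by (simp add: int_W integrable_Q_mult integrable_Q_square Bochner_Integration.integral_sum del: of_nat_Suc)
  also have "\<dots> \<le> 2 * ?C * harm n + (\<Sum>k=1..n. 2 * ?C / ?N\<^sup>2) + (?C * ?N\<^sup>2) / ?N ^ 4"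
    by (intro add_mono exp_W sum_mono cov divide_right_mono expectation_Q_square) auto
  also have "(?C * ?N\<^sup>2) / ?N ^ 4 = ?C / ?N\<^sup>2"
    by (simp add: power2_eq_square power4_eq_xxxx del: of_nat_Suc)
  also have "2 * ?C * harm n + (\<Sum>k=1..n. 2 * ?C / ?N\<^sup>2) + ?C / ?N\<^sup>2
      = 2 * ?C * harm n + ?C * (2 * real n + 1) / ?N\<^sup>2"
    by (simp add: field_simps del: of_nat_Suc)
  also have "\<dots> \<le> 2 * ?C * harm n + ?C * (2 * ?N) / ?N\<^sup>2"
    using \<kappa>_nonneg by (intro add_left_mono divide_right_mono mult_left_mono) auto
  also have "\<dots> = 2 * ?C * harm (Suc n)"
    by (simp add: harm_Suc power2_eq_square inverse_eq_divide distrib_left del: of_nat_Suc)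
  finally show "expectation (\<lambda>\<omega>. (\<Sum>k=1..Suc n. Q k \<omega> / (real k)\<^sup>2)\<^sup>2) \<le> 2 * ?C * harm (Suc n)" .
qed

end

section \<open>Almost sure divergence of the squares\<close>

text \<open>
  The square of the distance between \<open>K\<close> and \<open>b n\<close> grows quadratically in \<open>b n\<close>, the mean square
  deviation only linearly, so Markov's inequality makes staying below \<open>K\<close> forever a null event.
\<close>

lemma (in prob_space) AE_exceeds_if_square_deviation_linear:
  fixes T :: "nat \<Rightarrow> 'a \<Rightarrow> real" and b :: "nat \<Rightarrow> real"
  assumes [measurable]: "\<And>n. T n \<in> borel_measurable M"
    and int: "\<And>n. integrable M (\<lambda>\<omega>. (T n \<omega> - b n)\<^sup>2)"
    and le: "\<And>n. expectation (\<lambda>\<omega>. (T n \<omega> - b n)\<^sup>2) \<le> C * b n"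
    and b: "filterlim b at_top sequentially"
  shows "AE \<omega> in M. \<forall>K::nat. \<exists>n. real K < T n \<omega>"
  unfolding AE_all_countable
proof
  fix K :: nat
  define U where "U = {\<omega> \<in> space M. \<forall>n. T n \<omega> \<le> real K}"
  have [measurable]: "U \<in> events"
    unfolding U_def by measurable
  have "prob U \<le> C * b n / (b n - real K)\<^sup>2" if "real K < b n" for n
  proof -
    have "prob U \<le> prob {\<omega> \<in> space M. (b n - real K)\<^sup>2 \<le> (T n \<omega> - b n)\<^sup>2}"
    proof (rule finite_measure_mono)
      show "U \<subseteq> {\<omega> \<in> space M. (b n - real K)\<^sup>2 \<le> (T n \<omega> - b n)\<^sup>2}"
      proof
        fix \<omega> assume "\<omega> \<in> U"
        then have "\<omega> \<in> space M" "T n \<omega> \<le> real K"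
          by (auto simp: U_def)
        moreover from this have "(b n - real K)\<^sup>2 \<le> (b n - T n \<omega>)\<^sup>2"
          using that by (intro power_mono) auto
        ultimately show "\<omega> \<in> {\<omega> \<in> space M. (b n - real K)\<^sup>2 \<le> (T n \<omega> - b n)\<^sup>2}"
          by (simp add: power2_commute)
      qed
    qed measurable
    also have "\<dots> \<le> expectation (\<lambda>\<omega>. (T n \<omega> - b n)\<^sup>2) / (b n - real K)\<^sup>2"
      by (rule integral_Markov_inequality_measure[where A = "space M"]) (use int that in auto)
    also have "\<dots> \<le> C * b n / (b n - real K)\<^sup>2"
      by (intro divide_right_mono le) simp
    finally show ?thesis .
  qed
  then have ev: "eventually (\<lambda>n. prob U \<le> C * b n / (b n - real K)\<^sup>2) sequentially"
    by (rule eventually_mono[OF filterlim_at_top_dense[THEN iffD1, OF b, rule_format]])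
  have "((\<lambda>x. C * x / (x - real K)\<^sup>2) \<longlongrightarrow> 0) at_top"
    by real_asymp
  then have "(\<lambda>n. C * b n / (b n - real K)\<^sup>2) \<longlonglongrightarrow> 0"
    by (rule filterlim_compose[OF _ b])
  then have "prob U \<le> 0"
    by (rule tendsto_lowerbound[OF _ ev]) simp
  then have "prob U = 0"
    using measure_nonneg[of M U] by linarith
  then have "AE \<omega> in M. \<omega> \<notin> U"
    by (simp add: prob_eq_0)
  then show "AE \<omega> in M. \<exists>n. real K < T n \<omega>"
    by (rule AE_mp) (intro AE_I2, auto simp: U_def not_le)
qed

lemma (in centred_sums_fourth) AE_sum_squares_exceeds:
  assumes "0 < v"
  shows "AE \<omega> in M. \<forall>K::nat. \<exists>n. real K < (\<Sum>k=1..n. (S k \<omega> / real k)\<^sup>2)"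
proof (rule AE_exceeds_if_square_deviation_linear)
  fix n
  have eq: "(\<Sum>k=1..n. (S k \<omega> / real k)\<^sup>2) - v * harm n = (\<Sum>k=1..n. Q k \<omega> / (real k)\<^sup>2)" for \<omega>
    unfolding harm_def sum_distrib_left sum_subtractf[symmetric]
    by (intro sum.cong) (auto simp: Q_def field_simps power2_eq_square)
  show "integrable M (\<lambda>\<omega>. ((\<Sum>k=1..n. (S k \<omega> / real k)\<^sup>2) - v * harm n)\<^sup>2)"
    unfolding eq by (rule integrable_weighted_sum_square)
  show "expectation (\<lambda>\<omega>. ((\<Sum>k=1..n. (S k \<omega> / real k)\<^sup>2) - v * harm n)\<^sup>2)
      \<le> 2 * (\<kappa> + 3 * v\<^sup>2) / v * (v * harm n)"
    unfolding eq using expectation_weighted_sum_square[of n] assms by simp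
  show "filterlim (\<lambda>n. v * harm n) at_top sequentially"
    by (rule filterlim_tendsto_pos_mult_at_top[OF tendsto_const assms harm_at_top])
qed measurable

section \<open>Summability of powers along a path\<close>

lemma summable_square_if_summable_powr:
  fixes a :: "nat \<Rightarrow> real"
  assumes sum: "summable (\<lambda>n. \<bar>a n\<bar> powr \<alpha>)" and \<alpha>: "0 < \<alpha>" "\<alpha> \<le> 2"
  shows "summable (\<lambda>n. (a n)\<^sup>2)"
proof (rule summable_comparison_test_ev[OF _ sum])
  have "eventually (\<lambda>n. \<bar>a n\<bar> powr \<alpha> < 1) sequentially"
    by (rule order_tendstoD[OF summable_LIMSEQ_zero[OF sum]]) simp
  then show "eventually (\<lambda>n. norm ((a n)\<^sup>2) \<le> \<bar>a n\<bar> powr \<alpha>) sequentially"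
  proof eventually_elim
    case (elim n)
    show ?case
    proof (cases "a n = 0")
      case False
      have "\<bar>a n\<bar> \<le> 1"
        using elim ge_one_powr_ge_zero[of "\<bar>a n\<bar>" \<alpha>] \<alpha> by linarith
      then have "\<bar>a n\<bar> powr 2 \<le> \<bar>a n\<bar> powr \<alpha>"
        using \<alpha> by (intro powr_mono') auto
      then show ?thesis
        using False by simp
    qed simp
  qed
qed

text \<open>
  A growth \<open>s\<^sub>k\<^sup>2 = O(k powr \<beta>)\<close> bounds the terms by a multiple of \<open>k powr ((\<beta>/2 - 1) * \<alpha>)\<close>, which
  is summable exactly if \<open>\<beta> < 2 - 2/\<alpha>\<close>, while the maximal inequality supplies this growth for
  \<open>\<beta> > 1\<close>. The exponent \<open>3/2 - 1/\<alpha>\<close> is the midpoint of the two bounds, and \<open>\<alpha> > 2\<close> is what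
  leaves room between them.
\<close>

lemma summable_powr_if_square_growth:
  fixes s :: "nat \<Rightarrow> real"
  assumes "2 < \<alpha>"
    and bound: "\<And>k. 1 \<le> k \<Longrightarrow> (s k)\<^sup>2 \<le> K * real k powr (3/2 - 1/\<alpha>)"
  shows "summable (\<lambda>n. \<bar>s (Suc n) / real (Suc n)\<bar> powr \<alpha>)"
proof (rule summable_comparison_test')
  have "summable (\<lambda>n. real (Suc n) powr (- \<alpha>/4 - 1/2))"
    using assms by (subst summable_Suc_iff) (simp add: summable_real_powr_iff)
  then show "summable (\<lambda>n. K powr (\<alpha>/2) * real (Suc n) powr (- \<alpha>/4 - 1/2))"
    by (rule summable_mult)
  fix n
  define x where "x = real (Suc n)"
  have "0 < x"
    by (simp add: x_def)
  have K: "0 \<le> K"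
    using bound[of 1] order_trans[OF zero_le_power2] by fastforce
  have "\<bar>s (Suc n) / x\<bar> powr \<alpha> = ((s (Suc n))\<^sup>2 / x\<^sup>2) powr (\<alpha>/2)"
  proof (cases "s (Suc n) = 0")
    case False
    have "\<bar>s (Suc n) / x\<bar> powr \<alpha> = (\<bar>s (Suc n) / x\<bar> powr 2) powr (\<alpha>/2)"
      unfolding powr_powr by simp
    also have "\<bar>s (Suc n) / x\<bar> powr 2 = (s (Suc n))\<^sup>2 / x\<^sup>2"
      using False \<open>0 < x\<close> by (simp add: power_divide)
    finally show ?thesis .
  qed simp
  also have "\<dots> \<le> (K * x powr (3/2 - 1/\<alpha>) / x\<^sup>2) powr (\<alpha>/2)"
    using bound[of "Suc n"] assms by (intro powr_mono2 divide_right_mono) (auto simp: x_def)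
  also have "K * x powr (3/2 - 1/\<alpha>) / x\<^sup>2 = K * x powr (-1/2 - 1/\<alpha>)"
  proof -
    have "x\<^sup>2 = x powr 2"
      using \<open>0 < x\<close> by simp
    then show ?thesis
      by (simp only: times_divide_eq_right[symmetric] powr_diff[symmetric]) simp
  qed
  also have "(K * x powr (-1/2 - 1/\<alpha>)) powr (\<alpha>/2) = K powr (\<alpha>/2) * x powr ((-1/2 - 1/\<alpha>) * (\<alpha>/2))"
    using K by (simp add: powr_mult powr_powr)
  also have "(-1/2 - 1/\<alpha>) * (\<alpha>/2) = - \<alpha>/4 - 1/2"
    using assms by (simp add: field_simps)
  finally show "norm (\<bar>s (Suc n) / real (Suc n)\<bar> powr \<alpha>) \<le> K powr (\<alpha>/2) * real (Suc n) powr (- \<alpha>/4 - 1/2)"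
    by (simp add: x_def)
qed

lemma (in centred_sums) AE_summable_powr:
  assumes "2 < \<alpha>"
  shows "AE \<omega> in M. summable (\<lambda>n. \<bar>S (Suc n) \<omega> / real (Suc n)\<bar> powr \<alpha>)"
proof -
  define \<beta> where "\<beta> = 3/2 - 1/\<alpha>"
  have \<beta>: "1 < \<beta>"
    using assms by (simp add: \<beta>_def field_simps)
  \<comment> \<open>The maximum with 1 matters only for \<open>k = 0\<close>: since \<open>0 powr - \<beta> = 0\<close>, the bare power would not be decreasing there.\<close>
  define c where "c k = real (max 1 k) powr - \<beta>" for k
  have "summable (\<lambda>n. real (Suc n) powr - \<beta>)"
    using \<beta> by (subst summable_Suc_iff) (simp add: summable_real_powr_iff)
  then have "summable (\<lambda>n. c (Suc n))"
    by (simp add: c_def)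
  then have "summable c"
    by (simp only: summable_Suc_iff)
  moreover have "c (Suc k) \<le> c k" "0 \<le> c k" for k
    unfolding c_def using \<beta> by (auto intro!: powr_mono2')
  ultimately have "AE \<omega> in M. \<exists>K. \<forall>k. c k * (S k \<omega>)\<^sup>2 \<le> K"
    by (intro AE_bounded_weighted_squares)
  then show ?thesis
  proof eventually_elim
    case (elim \<omega>)
    then obtain K where K: "\<And>k. c k * (S k \<omega>)\<^sup>2 \<le> K"
      by blast
    show ?case
    proof (rule summable_powr_if_square_growth[OF assms])
      fix k :: nat assume "1 \<le> k"
      then show "(S k \<omega>)\<^sup>2 \<le> K * real k powr (3/2 - 1/\<alpha>)"
        using K[of k] by (simp add: c_def max_def powr_minus_divide \<beta>_def[symmetric] field_simps)
    qed
  qed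
qed

section \<open>Identically distributed copies\<close>

lemma deviation_series_finite_iff:
  "deviation_series \<alpha> Y L \<omega> < \<infinity> \<longleftrightarrow> summable (\<lambda>n. \<bar>Y (Suc n) \<omega> - L \<omega>\<bar> powr \<alpha>)"
  unfolding deviation_series_def infinity_ennreal_def less_top[symmetric]
proof
  assume "(\<Sum>n. ennreal (\<bar>Y (Suc n) \<omega> - L \<omega>\<bar> powr \<alpha>)) \<noteq> \<top>"
  then show "summable (\<lambda>n. \<bar>Y (Suc n) \<omega> - L \<omega>\<bar> powr \<alpha>)"
    by (rule summable_suminf_not_top[rotated]) simp
qed (rule ennreal_suminf_neq_top, simp_all)

lemma (in prob_space) iid_copies_transfer:
  fixes g :: "real \<Rightarrow> real"
  assumes "iid_copies M X Xs" "1 \<le> i" and [measurable]: "g \<in> borel_measurable borel"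
  shows "integrable M (\<lambda>\<omega>. g (Xs i \<omega>)) \<longleftrightarrow> integrable M (\<lambda>\<omega>. g (X \<omega>))"
    and "(\<integral>\<omega>. g (Xs i \<omega>) \<partial>M) = (\<integral>\<omega>. g (X \<omega>) \<partial>M)"
proof -
  have distr: "distr M borel (Xs i) = distr M borel X" and [measurable]: "X \<in> borel_measurable M"
    using assms by (auto simp: iid_copies_def)
  have [measurable]: "Xs i \<in> borel_measurable M"
    using assms by (auto simp: iid_copies_def indep_vars_def)
  have "integrable M (\<lambda>\<omega>. g (Xs i \<omega>)) \<longleftrightarrow> integrable (distr M borel (Xs i)) g"
    by (simp add: integrable_distr_eq)
  also have "\<dots> \<longleftrightarrow> integrable M (\<lambda>\<omega>. g (X \<omega>))"
    by (simp add: distr integrable_distr_eq)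
  finally show "integrable M (\<lambda>\<omega>. g (Xs i \<omega>)) \<longleftrightarrow> integrable M (\<lambda>\<omega>. g (X \<omega>))" .
  have "(\<integral>\<omega>. g (Xs i \<omega>) \<partial>M) = (\<integral>x. g x \<partial>distr M borel (Xs i))"
    by (simp add: integral_distr)
  also have "\<dots> = (\<integral>\<omega>. g (X \<omega>) \<partial>M)"
    by (simp add: distr integral_distr)
  finally show "(\<integral>\<omega>. g (Xs i \<omega>) \<partial>M) = (\<integral>\<omega>. g (X \<omega>) \<partial>M)" .
qed

lemma (in prob_space) centred_sums_if_iid_copies:
  assumes iid: "iid_copies M X Xs" and square: "integrable M (\<lambda>\<omega>. (X \<omega>)\<^sup>2)"
  shows "centred_sums M (\<lambda>i \<omega>. Xs i \<omega> - expectation X) (variance X)"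
proof unfold_locales
  have [measurable]: "X \<in> borel_measurable M" and indep: "indep_vars (\<lambda>_. borel) Xs {1..}"
    using iid by (auto simp: iid_copies_def)
  have int: "integrable M X"
    by (rule square_integrable_imp_integrable[OF _ square]) simp
  show "indep_vars (\<lambda>_. borel) (\<lambda>i \<omega>. Xs i \<omega> - expectation X) {1..}"
    by (rule indep_vars_compose2[OF indep]) simp
  fix i :: nat assume "1 \<le> i"
  note transfer = iid_copies_transfer[OF iid this]
  show "integrable M (\<lambda>\<omega>. (Xs i \<omega> - expectation X)\<^sup>2)"
    using transfer(1)[of "\<lambda>x. (x - expectation X)\<^sup>2"] int square by (simp add: power2_diff)
  show "expectation (\<lambda>\<omega>. Xs i \<omega> - expectation X) = 0"
    using transfer(2)[of "\<lambda>x. x - expectation X"] int by (simp add: prob_space)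
  show "expectation (\<lambda>\<omega>. (Xs i \<omega> - expectation X)\<^sup>2) = variance X"
    using transfer(2)[of "\<lambda>x. (x - expectation X)\<^sup>2"] by simp
qed

lemma (in prob_space) centred_sums_fourth_if_iid_copies:
  assumes iid: "iid_copies M X Xs" and fourth: "integrable M (\<lambda>\<omega>. X \<omega> ^ 4)"
  shows "centred_sums_fourth M (\<lambda>i \<omega>. Xs i \<omega> - expectation X) (variance X)
    (expectation (\<lambda>\<omega>. (X \<omega> - expectation X) ^ 4))"
proof -
  have [measurable]: "X \<in> borel_measurable M"
    using iid by (simp add: iid_copies_def)
  have int: "integrable M (\<lambda>\<omega>. X \<omega> ^ j)" if "j \<le> 4" for j
    by (rule integrable_power_le[OF _ fourth]) (use that in auto)
  have eq: "(\<lambda>\<omega>. (X \<omega> - a) ^ 4)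
      = (\<lambda>\<omega>. X \<omega> ^ 4 - 4 * a * X \<omega> ^ 3 + 6 * a\<^sup>2 * X \<omega> ^ 2 - 4 * a ^ 3 * X \<omega> ^ 1 + a ^ 4)" for a
    by (simp add: fun_eq_iff power2_eq_square power3_eq_cube power4_eq_xxxx algebra_simps)
  have int4: "integrable M (\<lambda>\<omega>. (X \<omega> - a) ^ 4)" for a
    unfolding eq by (intro Bochner_Integration.integrable_add Bochner_Integration.integrable_diff
        integrable_mult_right int integrable_const) auto
  interpret centred_sums M "\<lambda>i \<omega>. Xs i \<omega> - expectation X" "variance X"
    by (rule centred_sums_if_iid_copies[OF iid]) (use int[of 2] in simp)
  show ?thesis
  proof unfold_locales
    fix i :: nat assume "1 \<le> i"
    note transfer = iid_copies_transfer[OF iid this, of "\<lambda>x. (x - expectation X) ^ 4"]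
    show "integrable M (\<lambda>\<omega>. (Xs i \<omega> - expectation X) ^ 4)"
      using transfer(1) int4 by simp
    show "expectation (\<lambda>\<omega>. (Xs i \<omega> - expectation X) ^ 4) \<le> expectation (\<lambda>\<omega>. (X \<omega> - expectation X) ^ 4)"
      using transfer(2) by simp
  qed
qed

lemma (in prob_space) variance_pos_if_not_AE_const:
  fixes X :: "'a \<Rightarrow> real"
  assumes "integrable M (\<lambda>\<omega>. (X \<omega> - expectation X)\<^sup>2)" "\<not> (AE \<omega> in M. X \<omega> = expectation X)"
  shows "0 < variance X"
proof -
  have "variance X \<noteq> 0"
    using assms integral_nonneg_eq_0_iff_AE[OF assms(1)] by auto
  then show ?thesis
    using variance_positive[of X] by linarith
qed

theorem theorem2p5:
  fixes M :: "'a measure" and X :: "'a \<Rightarrow> real" and Xs :: "nat \<Rightarrow> 'a \<Rightarrow> real" and \<mu> :: real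
  assumes "prob_space M"
    and "iid_copies M X Xs"
    and "\<mu> = prob_space.expectation M X"
  shows "(integrable M (\<lambda>\<omega>. X \<omega> ^ 4) \<and> \<not> (AE \<omega> in M. X \<omega> = \<mu>) \<longrightarrow>
            (\<forall>\<alpha>::real. 0 < \<alpha> \<and> \<alpha> \<le> 2 \<longrightarrow>
               (AE \<omega> in M. deviation_series \<alpha> (sample_mean Xs) (\<lambda>_. \<mu>) \<omega> = \<infinity>))) \<and>
         (integrable M (\<lambda>\<omega>. \<bar>X \<omega>\<bar> ^ 2) \<longrightarrow>
            (\<forall>\<alpha>::real. 2 < \<alpha> \<longrightarrow>
               strongly_as_converges M \<alpha> (sample_mean Xs) (\<lambda>_. \<mu>)))"
proof (intro conjI impI allI)
  interpret prob_space M by fact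
  note iid = \<open>iid_copies M X Xs\<close>
  have [measurable]: "X \<in> borel_measurable M"
    using iid by (simp add: iid_copies_def)
  let ?Y = "\<lambda>i \<omega>. Xs i \<omega> - \<mu>"
  have mean: "sample_mean Xs (Suc n) \<omega> - \<mu> = (\<Sum>i=1..Suc n. ?Y i \<omega>) / real (Suc n)" for n \<omega>
    unfolding sample_mean_def sum_subtractf by (simp add: diff_divide_distrib del: sum.cl_ivl_Suc of_nat_Suc)
  {
    fix \<alpha> :: real
    assume fourth: "integrable M (\<lambda>\<omega>. X \<omega> ^ 4) \<and> \<not> (AE \<omega> in M. X \<omega> = \<mu>)" and \<alpha>: "0 < \<alpha> \<and> \<alpha> \<le> 2"
    interpret centred_sums_fourth M ?Y "variance X" "expectation (\<lambda>\<omega>. (X \<omega> - \<mu>) ^ 4)"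
      unfolding assms(3) using fourth by (intro centred_sums_fourth_if_iid_copies[OF iid]) blast
    have "integrable M (\<lambda>\<omega>. (X \<omega> - \<mu>)\<^sup>2)"
      by (rule iid_copies_transfer(1)[OF iid order_refl, of "\<lambda>x. (x - \<mu>)\<^sup>2", THEN iffD1])
        (auto intro: integrable_square)
    then have "0 < variance X"
      using fourth unfolding assms(3) by (intro variance_pos_if_not_AE_const) blast+
    then have "AE \<omega> in M. \<forall>K::nat. \<exists>n. real K < (\<Sum>k=1..n. (S k \<omega> / real k)\<^sup>2)"
      by (rule AE_sum_squares_exceeds)
    then show "AE \<omega> in M. deviation_series \<alpha> (sample_mean Xs) (\<lambda>_. \<mu>) \<omega> = \<infinity>"
    proof eventually_elim
      case (elim \<omega>)
      show ?case
      proof (rule ccontr)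
        assume "deviation_series \<alpha> (sample_mean Xs) (\<lambda>_. \<mu>) \<omega> \<noteq> \<infinity>"
        then have "deviation_series \<alpha> (sample_mean Xs) (\<lambda>_. \<mu>) \<omega> < \<infinity>"
          by (simp only: infinity_ennreal_def less_top)
        then have "summable (\<lambda>n. \<bar>S (Suc n) \<omega> / real (Suc n)\<bar> powr \<alpha>)"
          unfolding deviation_series_finite_iff mean S_def .
        then have sum: "summable (\<lambda>n. (S (Suc n) \<omega> / real (Suc n))\<^sup>2)"
          by (rule summable_square_if_summable_powr) (use \<alpha> in auto)
        obtain K :: nat where K: "(\<Sum>n. (S (Suc n) \<omega> / real (Suc n))\<^sup>2) \<le> real K"
          using real_arch_simple by blast
        obtain n where "real K < (\<Sum>k=1..n. (S k \<omega> / real k)\<^sup>2)"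
          using elim by blast
        also have "\<dots> = (\<Sum>k<n. (S (Suc k) \<omega> / real (Suc k))\<^sup>2)"
          by (simp add: sum.atLeast1_atMost_eq)
        also have "\<dots> \<le> real K"
          using sum_le_suminf[OF sum, of "{..<n}"] K by simp
        finally show False
          by simp
      qed
    qed
  }
  fix \<alpha> :: real
  assume square: "integrable M (\<lambda>\<omega>. \<bar>X \<omega>\<bar> ^ 2)" and \<alpha>: "2 < \<alpha>"
  interpret centred_sums M ?Y "variance X"
    unfolding assms(3) using square by (intro centred_sums_if_iid_copies[OF iid]) simp
  have [measurable]: "Xs i \<in> borel_measurable M" if "1 \<le> i" for i
    using iid that unfolding iid_copies_def indep_vars_def by auto
  have "sample_mean Xs n \<in> borel_measurable M" for n
    unfolding sample_mean_def[abs_def] by measurable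
  moreover have "AE \<omega> in M. deviation_series \<alpha> (sample_mean Xs) (\<lambda>_. \<mu>) \<omega> < \<infinity>"
    using AE_summable_powr[OF \<alpha>] unfolding deviation_series_finite_iff mean S_def .
  ultimately show "strongly_as_converges M \<alpha> (sample_mean Xs) (\<lambda>_. \<mu>)"
    unfolding strongly_as_converges_def using \<alpha> by simp
qed

end
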